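(* Let $A,B$ be disjoint sets with $|A|=|B|=n$, and let $G$ and $H$ be bipartite graphs on the vertex set $A\cup B$, both with bipartition $(A,B)$. Suppose $G$ is $r$-regular, $H$ is $s$-regular, and $E(G)\cap E(H)=\emptyset$. If $r>\frac{n}{2}+s^2$, then there exists a perfect matching in $G$ which is acceptable for $H$.
   Context: A perfect matching $M$ in $G$ is called acceptable for $H$ if no two edges of $M$ form a 4-cycle with two edges of $H$; that is, there are no two distinct edges $(a,b),(a',b')\in M$ with $a,a'\in A$, $b,b'\in B$ such that both $(a,b')$ and $(a',b)$ are edges of $H$. *)

theory Defs
  imports Complex_Main
begin

text \<open>A simple graph is given by its vertex set and its set of edges, an edge being the
  two-element set of its endpoints.\<close>

definition bipartite_graph :: "'a set \<Rightarrow> 'a set \<Rightarrow> 'a set set \<Rightarrow> bool" where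
  "bipartite_graph A B E \<longleftrightarrow>
     A \<inter> B = {} \<and> (\<forall>e\<in>E. \<exists>a\<in>A. \<exists>b\<in>B. e = {a, b})"

definition degree :: "'a set set \<Rightarrow> 'a \<Rightarrow> nat" where
  "degree E v = card {e \<in> E. v \<in> e}"

definition regular_graph :: "'a set \<Rightarrow> 'a set set \<Rightarrow> nat \<Rightarrow> bool" where
  "regular_graph V E r \<longleftrightarrow> (\<forall>v\<in>V. degree E v = r)"

definition perfect_matching :: "'a set \<Rightarrow> 'a set set \<Rightarrow> 'a set set \<Rightarrow> bool" where
  "perfect_matching V E M \<longleftrightarrow> M \<subseteq> E \<and> pairwise disjnt M \<and> \<Union>M = V"

text \<open>The edges of the forbidden 4-cycle alternate between \<open>M\<close> and \<open>H\<close>.\<close>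

definition acceptable :: "'a set \<Rightarrow> 'a set \<Rightarrow> 'a set set \<Rightarrow> 'a set set \<Rightarrow> bool" where
  "acceptable A B H M \<longleftrightarrow>
     \<not> (\<exists>a\<in>A. \<exists>a'\<in>A. \<exists>b\<in>B. \<exists>b'\<in>B.
          {a, b} \<in> M \<and> {a', b'} \<in> M \<and> {a, b} \<noteq> {a', b'} \<and>
          {a, b'} \<in> H \<and> {a', b} \<in> H)"

end

theory Submission
  imports Defs "HOL-Combinatorics.Transposition"
begin

text \<open>A perfect matching of the complete bipartite graph on \<open>A \<union> B\<close> is a bijection
  \<open>f\<close> from \<open>A\<close> to \<open>B\<close>, and the proof improves such a bijection by switching: for
  \<open>a, x \<in> A\<close> the values \<open>f a\<close> and \<open>f x\<close> are exchanged.  The switch introduces only edges of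
  \<open>G\<close> when both \<open>(a, f x)\<close> and \<open>(x, f a)\<close> lie in \<open>G\<close>; as \<open>G\<close> has minimum degree at least
  \<open>r\<close>, at least \<open>2 r - n \<ge> 2 s\<^sup>2 + 1\<close> elements \<open>x\<close> have this property
  (\<open>card_switch_candidates\<close>).

  If \<open>(a, f a)\<close> is not an edge of \<open>G\<close>, any such switch increases the number of matching edges
  in \<open>G\<close>; so a bijection that maximises this number is a perfect matching of \<open>G\<close>
  (\<open>exists_bij_into_graph\<close>).

  Among these, take one with the fewest conflicts, a conflict being two matching edges that
  form a 4-cycle with two edges of \<open>H\<close>.  Suppose that \<open>a\<close> and \<open>a'\<close> are in conflict.
  After a switch of \<open>a\<close> with \<open>x\<close>, the edge \<open>(a, f x)\<close> is in conflict with an old edge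
  only if \<open>x\<close> is reached from \<open>a\<close> by a walk that alternates between edges of \<open>H\<close>, matching
  edges, \<open>H\<close> and the matching again; there are at most \<open>s\<^sup>2\<close> such \<open>x\<close>.  The same bound holds for the
  edge \<open>(x, f a)\<close>, with the walk traversed backwards.  So some candidate \<open>x\<close>
  creates no conflict with an old edge.  It differs from \<open>a\<close>, because \<open>a\<close>
  itself is reached by such a walk through \<open>a'\<close>; and the two new edges are not in conflict with
  each other, since \<open>(a, f a)\<close> is in \<open>G\<close> and hence not in \<open>H\<close>.  The switch
  destroys the conflict of \<open>a\<close> and \<open>a'\<close> and creates none, contradicting minimality.\<close>

section \<open>Switching two values of a bijection\<close>

lemma card_Collect_bij_betw:
  assumes "bij_betw f A B"
  shows "card {x \<in> A. P (f x)} = card {y \<in> B. P y}"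
proof (rule bij_betw_same_card)
  show "bij_betw f {x \<in> A. P (f x)} {y \<in> B. P y}"
    using assms by (auto simp: bij_betw_def inj_on_def)
qed

lemma card_switch_candidates:
  fixes g :: "'a \<Rightarrow> 'b \<Rightarrow> bool"
  assumes "finite A" and f: "bij_betw f A B" and "a \<in> A"
    and row: "\<And>a. a \<in> A \<Longrightarrow> r \<le> card {b \<in> B. g a b}"
    and col: "\<And>b. b \<in> B \<Longrightarrow> r \<le> card {a \<in> A. g a b}"
  shows "2 * r \<le> card {x \<in> A. g a (f x) \<and> g x (f a)} + card A"
proof -
  let ?P = "{x \<in> A. g a (f x)}" and ?Q = "{x \<in> A. g x (f a)}"
  have "r \<le> card ?P"
    using row[OF \<open>a \<in> A\<close>] card_Collect_bij_betw[OF f, of "g a"] by simp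
  moreover have "r \<le> card ?Q"
    using col f \<open>a \<in> A\<close> by (auto simp: bij_betw_def)
  moreover have "card ?P + card ?Q = card (?P \<union> ?Q) + card (?P \<inter> ?Q)"
    by (rule card_Un_Int) (use \<open>finite A\<close> in auto)
  moreover have "card (?P \<union> ?Q) \<le> card A"
    by (rule card_mono) (use \<open>finite A\<close> in auto)
  moreover have "?P \<inter> ?Q = {x \<in> A. g a (f x) \<and> g x (f a)}"
    by auto
  ultimately show ?thesis by simp
qed

lemma exists_bij_into_graph:
  fixes g :: "'a \<Rightarrow> 'b \<Rightarrow> bool"
  assumes "finite A" "finite B" "card A = card B" and "card A < 2 * r"
    and row: "\<And>a. a \<in> A \<Longrightarrow> r \<le> card {b \<in> B. g a b}"
    and col: "\<And>b. b \<in> B \<Longrightarrow> r \<le> card {a \<in> A. g a b}"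
  obtains f where "bij_betw f A B" and "\<And>a. a \<in> A \<Longrightarrow> g a (f a)"
proof -
  define miss where "miss f = {a \<in> A. \<not> g a (f a)}" for f
  obtain f0 where "bij_betw f0 A B"
    using finite_same_card_bij assms(1-3) by blast
  then obtain f where f: "bij_betw f A B"
    and least: "\<And>f'. bij_betw f' A B \<Longrightarrow> card (miss f) \<le> card (miss f')"
    using ex_has_least_nat[of "\<lambda>f. bij_betw f A B" f0 "\<lambda>f. card (miss f)"] by blast
  have "g a (f a)" if "a \<in> A" for a
  proof (rule ccontr)
    assume na: "\<not> g a (f a)"
    have "card {x \<in> A. g a (f x) \<and> g x (f a)} > 0"
      using card_switch_candidates[OF \<open>finite A\<close> f \<open>a \<in> A\<close> row col] \<open>card A < 2 * r\<close>
      by simp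
    then obtain x where x: "x \<in> A" "g a (f x)" "g x (f a)"
      by (auto simp: card_gt_0_iff)
    define f' where "f' = f \<circ> transpose a x"
    have "bij_betw f' A B"
      unfolding f'_def using f \<open>a \<in> A\<close> x(1) by (simp add: bij_betw_swap_iff)
    moreover have "miss f' \<subset> miss f"
      using na x \<open>a \<in> A\<close> by (auto simp: miss_def f'_def transpose_def split: if_splits)
    then have "card (miss f') < card (miss f)"
      by (rule psubset_card_mono[rotated]) (use \<open>finite A\<close> in \<open>simp add: miss_def\<close>)
    ultimately show False
      using least by fastforce
  qed
  with f that show thesis by blast
qed

section \<open>Removing conflicts\<close>

text \<open>The pairs of distinct elements of \<open>A\<close> whose matching edges form a 4-cycle with two
  edges of \<open>h\<close>; each unordered pair occurs in both orders.\<close>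

definition conflicts :: "'a set \<Rightarrow> ('a \<Rightarrow> 'b \<Rightarrow> bool) \<Rightarrow> ('a \<Rightarrow> 'b) \<Rightarrow> ('a \<times> 'a) set" where
  "conflicts A h f = {(x, y) \<in> A \<times> A. x \<noteq> y \<and> h x (f y) \<and> h y (f x)}"

text \<open>Applied to the relations obtained from \<open>h\<close> and its converse by identifying \<open>B\<close> with
  \<open>A\<close> along \<open>f\<close>, this bounds the number of switches that create a new conflict.\<close>

lemma card_two_step_le:
  assumes "finite A" and "\<And>y. y \<in> A \<Longrightarrow> card {x \<in> A. R y x} \<le> s" and "a \<in> A"
  shows "card {x \<in> A. \<exists>y \<in> A. R a y \<and> R y x} \<le> s\<^sup>2"
proof -
  let ?Y = "{y \<in> A. R a y}"
  have "{x \<in> A. \<exists>y \<in> A. R a y \<and> R y x} = (\<Union>y \<in> ?Y. {x \<in> A. R y x})"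
    by auto
  also have "card \<dots> \<le> (\<Sum>y \<in> ?Y. card {x \<in> A. R y x})"
    by (rule card_UN_le) (use \<open>finite A\<close> in simp)
  also have "\<dots> \<le> card ?Y * s"
    using sum_bounded_above[of ?Y "\<lambda>y. card {x \<in> A. R y x}" s] assms(2) by simp
  also have "\<dots> \<le> s\<^sup>2"
    using assms(2)[OF \<open>a \<in> A\<close>] by (simp add: power2_eq_square)
  finally show ?thesis .
qed

lemma exists_bij_without_conflicts:
  fixes g h :: "'a \<Rightarrow> 'b \<Rightarrow> bool"
  assumes "finite A" "finite B" "card A = card B" and big: "card A + 2 * s\<^sup>2 < 2 * r"
    and grow: "\<And>a. a \<in> A \<Longrightarrow> r \<le> card {b \<in> B. g a b}"
    and gcol: "\<And>b. b \<in> B \<Longrightarrow> r \<le> card {a \<in> A. g a b}"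
    and hrow: "\<And>a. a \<in> A \<Longrightarrow> card {b \<in> B. h a b} \<le> s"
    and hcol: "\<And>b. b \<in> B \<Longrightarrow> card {a \<in> A. h a b} \<le> s"
    and disj: "\<And>a b. g a b \<Longrightarrow> \<not> h a b"
  obtains f where "bij_betw f A B" and "\<And>a. a \<in> A \<Longrightarrow> g a (f a)"
    and "conflicts A h f = {}"
proof -
  define good where "good f \<longleftrightarrow> bij_betw f A B \<and> (\<forall>a \<in> A. g a (f a))" for f
  have "card A < 2 * r"
    using big by simp
  then obtain f0 where "good f0"
    using exists_bij_into_graph[OF assms(1-3) _ grow gcol] unfolding good_def by metis
  then obtain f where "good f"
    and least: "\<And>f'. good f' \<Longrightarrow> card (conflicts A h f) \<le> card (conflicts A h f')"
    using ex_has_least_nat[of good f0 "\<lambda>f. card (conflicts A h f)"] by blast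
  then have f: "bij_betw f A B" and gf: "\<And>a. a \<in> A \<Longrightarrow> g a (f a)"
    by (auto simp: good_def)
  have "conflicts A h f = {}"
  proof (rule ccontr)
    assume "conflicts A h f \<noteq> {}"
    then obtain a a' where "(a, a') \<in> conflicts A h f"
      by auto
    then have a: "a \<in> A" "a' \<in> A" "a \<noteq> a'" "h a (f a')" "h a' (f a)"
      by (auto simp: conflicts_def)
    let ?X = "{x \<in> A. g a (f x) \<and> g x (f a)}"
    \<comment> \<open>\<open>?U\<close> collects the \<open>x\<close> for which \<open>(a, f x)\<close> conflicts with an edge \<open>(y, f y)\<close>,
      and \<open>?V\<close> those for which \<open>(x, f a)\<close> does.\<close>
    let ?U = "{x \<in> A. \<exists>y \<in> A. h a (f y) \<and> h y (f x)}"
    let ?V = "{x \<in> A. \<exists>y \<in> A. h y (f a) \<and> h x (f y)}"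
    have "card ?U \<le> s\<^sup>2"
      by (rule card_two_step_le[where R = "\<lambda>y x. h y (f x)"])
        (use assms(1) a(1) hrow card_Collect_bij_betw[OF f] in auto)
    moreover have "card ?V \<le> s\<^sup>2"
      by (rule card_two_step_le[where R = "\<lambda>y x. h x (f y)"])
        (use assms(1) a(1) hcol f in \<open>auto simp: bij_betw_def\<close>)
    ultimately have "card (?U \<union> ?V) < card ?X"
      using card_switch_candidates[OF \<open>finite A\<close> f a(1) grow gcol] big card_Un_le[of ?U ?V]
      by simp
    then have "\<not> ?X \<subseteq> ?U \<union> ?V"
      using card_mono[of "?U \<union> ?V" ?X] \<open>finite A\<close> by auto
    then obtain x where x: "x \<in> A" "g a (f x)" "g x (f a)"
      and U: "\<And>y. y \<in> A \<Longrightarrow> h a (f y) \<Longrightarrow> \<not> h y (f x)"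
      and V: "\<And>y. y \<in> A \<Longrightarrow> h y (f a) \<Longrightarrow> \<not> h x (f y)"
      by blast
    \<comment> \<open>The conflict with \<open>a'\<close> puts \<open>a\<close> itself into \<open>?U\<close>.\<close>
    have "x \<noteq> a"
      using U[of a'] a by blast
    define f' where "f' = f \<circ> transpose a x"
    have f'_simps: "f' a = f x" "f' x = f a" "\<And>y. y \<noteq> a \<Longrightarrow> y \<noteq> x \<Longrightarrow> f' y = f y"
      by (auto simp: f'_def)
    have "bij_betw f' A B"
      unfolding f'_def using f a(1) x(1) by (simp add: bij_betw_swap_iff)
    moreover have "g y (f' y)" if "y \<in> A" for y
      using gf[OF that] x by (auto simp: f'_def transpose_def)
    ultimately have "good f'"
      by (auto simp: good_def)
    have old: "\<not> (h a (f' y) \<and> h y (f' a))" "\<not> (h x (f' y) \<and> h y (f' x))"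
      if "y \<in> A" "y \<noteq> a" "y \<noteq> x" for y
      using U V that by (auto simp: f'_simps)
    \<comment> \<open>As \<open>f' x = f a\<close>, the two switched edges are not in conflict with each other.\<close>
    have new: "\<not> h a (f' x)"
      using disj gf a(1) by (simp add: f'_simps)
    have fixed: "y \<noteq> a \<and> y \<noteq> x \<and> z \<noteq> a \<and> z \<noteq> x" if "(y, z) \<in> conflicts A h f'" for y z
    proof -
      have yz: "y \<in> A" "z \<in> A" "y \<noteq> z" "h y (f' z)" "h z (f' y)"
        using that by (auto simp: conflicts_def)
      have "\<not> (y = a \<and> z = x)" "\<not> (y = x \<and> z = a)"
        using yz(4,5) new by auto
      with yz old[of y] old[of z] show ?thesis
        by (metis (no_types))
    qed
    have "conflicts A h f' \<subset> conflicts A h f"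
    proof
      show "conflicts A h f' \<subseteq> conflicts A h f"
      proof (rule subrelI)
        fix y z assume yz: "(y, z) \<in> conflicts A h f'"
        then show "(y, z) \<in> conflicts A h f"
          using fixed[OF yz] by (simp add: conflicts_def f'_simps)
      qed
      show "conflicts A h f' \<noteq> conflicts A h f"
        using fixed \<open>(a, a') \<in> conflicts A h f\<close> by blast
    qed
    moreover have "finite (conflicts A h f)"
      by (rule finite_subset[of _ "A \<times> A"]) (use \<open>finite A\<close> in \<open>auto simp: conflicts_def\<close>)
    ultimately have "card (conflicts A h f') < card (conflicts A h f)"
      by (rule psubset_card_mono[rotated])
    with least[OF \<open>good f'\<close>] show False by simp
  qed
  with f gf that show thesis by blast
qed

section \<open>Bipartite graphs as relations\<close>

lemma bipartite_graph_sym: "bipartite_graph A B E \<Longrightarrow> bipartite_graph B A E"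
  by (auto simp: bipartite_graph_def) (metis insert_commute)

lemma degree_eq_card_neighbours:
  assumes "bipartite_graph A B E" "a \<in> A"
  shows "degree E a = card {b \<in> B. {a, b} \<in> E}"
proof -
  have "{e \<in> E. a \<in> e} = (\<lambda>b. {a, b}) ` {b \<in> B. {a, b} \<in> E}"
    using assms unfolding bipartite_graph_def by fastforce
  moreover have "inj_on (\<lambda>b. {a, b}) {b \<in> B. {a, b} \<in> E}"
    by (auto simp: inj_on_def doubleton_eq_iff)
  ultimately show ?thesis
    unfolding degree_def by (simp add: card_image)
qed

lemma perfect_matching_of_bij:
  assumes "A \<inter> B = {}" and f: "bij_betw f A B" and "\<And>a. a \<in> A \<Longrightarrow> {a, f a} \<in> E"
  shows "perfect_matching (A \<union> B) E ((\<lambda>a. {a, f a}) ` A)"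
proof -
  have "disjnt {x, f x} {y, f y}" if "x \<in> A" "y \<in> A" "{x, f x} \<noteq> {y, f y}" for x y
  proof -
    have "f x \<noteq> f y" using that f by (auto simp: bij_betw_def inj_on_def)
    moreover have "f x \<in> B" "f y \<in> B" using that f by (auto simp: bij_betw_def)
    ultimately show ?thesis using that assms(1) by (auto simp: disjnt_def)
  qed
  moreover have "\<Union> ((\<lambda>a. {a, f a}) ` A) = A \<union> B"
    using f by (auto simp: bij_betw_def)
  ultimately show ?thesis
    using assms(3) unfolding perfect_matching_def pairwise_def by auto
qed

theorem theorem6:
  fixes A B :: "'a set" and G H :: "'a set set" and n r s :: nat
  assumes "finite A" and "finite B" and "A \<inter> B = {}"
    and "card A = n" and "card B = n"
    and "bipartite_graph A B G" and "bipartite_graph A B H"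
    and "regular_graph (A \<union> B) G r" and "regular_graph (A \<union> B) H s"
    and "G \<inter> H = {}"
    and "real r > real n / 2 + (real s)\<^sup>2"
  shows "\<exists>M. perfect_matching (A \<union> B) G M \<and> acceptable A B H M"
proof -
  have row: "card {b \<in> B. {a, b} \<in> E} = k"
    if "bipartite_graph A B E" "regular_graph (A \<union> B) E k" "a \<in> A" for E k a
    using that degree_eq_card_neighbours[of A B E a] by (auto simp: regular_graph_def)
  have col: "card {a \<in> A. {a, b} \<in> E} = k"
    if "bipartite_graph A B E" "regular_graph (A \<union> B) E k" "b \<in> B" for E k b
    using that degree_eq_card_neighbours[OF bipartite_graph_sym, of A B E b]
    by (auto simp: regular_graph_def insert_commute)
  have "real (n + 2 * s\<^sup>2) < real (2 * r)"
    using assms(11) by simp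
  then have big: "card A + 2 * s\<^sup>2 < 2 * r"
    using assms(4) by linarith
  have eq: "card A = card B"
    using assms(4,5) by simp
  obtain f where f: "bij_betw f A B" "\<And>a. a \<in> A \<Longrightarrow> {a, f a} \<in> G"
    and nc: "conflicts A (\<lambda>a b. {a, b} \<in> H) f = {}"
  proof (rule exists_bij_without_conflicts[OF assms(1,2) eq big,
        where g = "\<lambda>a b. {a, b} \<in> G" and h = "\<lambda>a b. {a, b} \<in> H"])
    show "{a, b} \<notin> H" if "{a, b} \<in> G" for a b
      using that assms(10) by blast
  qed (simp_all add: row[OF assms(6,8)] col[OF assms(6,8)] row[OF assms(7,9)] col[OF assms(7,9)])
  let ?M = "(\<lambda>a. {a, f a}) ` A"
  have M: "b = f a" if "{a, b} \<in> ?M" "b \<in> B" for a b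
  proof -
    from \<open>{a, b} \<in> ?M\<close> obtain x where x: "x \<in> A" "{a, b} = {x, f x}"
      by blast
    moreover have "b \<noteq> x"
      using \<open>b \<in> B\<close> x(1) assms(3) by blast
    ultimately show ?thesis by (auto simp: doubleton_eq_iff)
  qed
  have "acceptable A B H ?M"
    unfolding acceptable_def
  proof (intro notI, elim bexE conjE)
    fix a a' b b'
    assume a: "a \<in> A" "a' \<in> A" and "b \<in> B" "b' \<in> B" "{a, b} \<in> ?M" "{a', b'} \<in> ?M"
      and ne: "{a, b} \<noteq> {a', b'}" and h: "{a, b'} \<in> H" "{a', b} \<in> H"
    have b: "b = f a" "b' = f a'"
      by (rule M; fact)+
    then have "a \<noteq> a'"
      using ne by blast
    with a h have "(a, a') \<in> conflicts A (\<lambda>a b. {a, b} \<in> H) f"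
      by (simp add: conflicts_def b)
    with nc show False by simp
  qed
  with perfect_matching_of_bij[OF assms(3) f] show ?thesis by blast
qed

end
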